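(* Let $(S_7,\cdot)$ be the three-element commutative monoid $\{0,a,1\}$ with identity $1$, zero $0$ and $a\cdot a=0$. The ai-semiring $\mathcal{P}(S_7,\cdot)$ is nonfinitely based, i.e. there is no finite set of identities that defines the variety $\mathsf{V}(\mathcal{P}(S_7,\cdot))$ of ai-semirings.
   Context: An ai-semiring is an algebra $(S,+,\cdot)$ with $(S,+)$ a commutative idempotent semigroup, $(S,\cdot)$ a semigroup, and multiplication distributing over addition on both sides. No constants are in the signature. For a semigroup $S$, $\mathcal{P}(S)$ is the ai-semiring of all subsets of $S$ (including $\emptyset$) with $A+B=A\cup B$ and $AB=\{ab\mid a\in A,b\in B\}$. $\mathsf{V}(A)$ is the variety generated by $A$. *)

theory Defs
  imports Main "HOL-Library.FuncSet" "HOL-Library.Set_Algebras"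
begin

record 'a alg =
  carrier :: "'a set"
  add :: "'a \<Rightarrow> 'a \<Rightarrow> 'a"  (infixl \<open>\<oplus>\<index>\<close> 65)
  mul :: "'a \<Rightarrow> 'a \<Rightarrow> 'a"  (infixl \<open>\<odot>\<index>\<close> 70)

locale ai_semiring =
  fixes S :: "'a alg" (structure)
  assumes nonempty: "carrier S \<noteq> {}"
    and add_closed: "\<lbrakk>x \<in> carrier S; y \<in> carrier S\<rbrakk> \<Longrightarrow> x \<oplus> y \<in> carrier S"
    and mul_closed: "\<lbrakk>x \<in> carrier S; y \<in> carrier S\<rbrakk> \<Longrightarrow> x \<odot> y \<in> carrier S"
    and add_assoc: "\<lbrakk>x \<in> carrier S; y \<in> carrier S; z \<in> carrier S\<rbrakk> \<Longrightarrow> (x \<oplus> y) \<oplus> z = x \<oplus> (y \<oplus> z)"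
    and add_commute: "\<lbrakk>x \<in> carrier S; y \<in> carrier S\<rbrakk> \<Longrightarrow> x \<oplus> y = y \<oplus> x"
    and add_idem: "x \<in> carrier S \<Longrightarrow> x \<oplus> x = x"
    and mul_assoc: "\<lbrakk>x \<in> carrier S; y \<in> carrier S; z \<in> carrier S\<rbrakk> \<Longrightarrow> (x \<odot> y) \<odot> z = x \<odot> (y \<odot> z)"
    and distrib_left: "\<lbrakk>x \<in> carrier S; y \<in> carrier S; z \<in> carrier S\<rbrakk> \<Longrightarrow> x \<odot> (y \<oplus> z) = x \<odot> y \<oplus> x \<odot> z"
    and distrib_right: "\<lbrakk>x \<in> carrier S; y \<in> carrier S; z \<in> carrier S\<rbrakk> \<Longrightarrow> (x \<oplus> y) \<odot> z = x \<odot> z \<oplus> y \<odot> z"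

text \<open>The product \<open>A * B\<close> of sets is the one of \<^theory>\<open>HOL-Library.Set_Algebras\<close>.\<close>

definition power_semiring :: "'s::semigroup_mult set alg" where
  "power_semiring = \<lparr>carrier = UNIV, add = (\<union>), mul = (*)\<rparr>"

lemma ai_semiring_power_semiring: "ai_semiring power_semiring"
  by unfold_locales
    (fastforce simp: power_semiring_def set_times_def mult.assoc intro: mult.assoc[symmetric])+

datatype tm = Var nat | Add tm tm | Mul tm tm

type_synonym identity = "tm \<times> tm"

primrec eval :: "'a alg \<Rightarrow> (nat \<Rightarrow> 'a) \<Rightarrow> tm \<Rightarrow> 'a" where
  "eval S \<rho> (Var n) = \<rho> n"
| "eval S \<rho> (Add s t) = eval S \<rho> s \<oplus>\<^bsub>S\<^esub> eval S \<rho> t"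
| "eval S \<rho> (Mul s t) = eval S \<rho> s \<odot>\<^bsub>S\<^esub> eval S \<rho> t"

definition satisfies :: "'a alg \<Rightarrow> identity \<Rightarrow> bool" where
  "satisfies S e \<longleftrightarrow> (\<forall>\<rho>. range \<rho> \<subseteq> carrier S \<longrightarrow> eval S \<rho> (fst e) = eval S \<rho> (snd e))"

text \<open>
  The ai-semirings with carrier contained in \<open>'a\<close> that satisfy \<open>\<Sigma>\<close>. Since terms have countably many
  variables, an equational class is determined by its countable members, so comparing classes over
  any one infinite type \<open>'a\<close> amounts to comparing them over all types; over a finite type it does not.
\<close>

definition models :: "identity set \<Rightarrow> 'a alg set" where
  "models \<Sigma> = {S. ai_semiring S \<and> (\<forall>e\<in>\<Sigma>. satisfies S e)}"

definition power_alg :: "'i set \<Rightarrow> 'a alg \<Rightarrow> ('i \<Rightarrow> 'a) alg" where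
  "power_alg I A = \<lparr>carrier = I \<rightarrow>\<^sub>E carrier A,
     add = (\<lambda>f g. \<lambda>i\<in>I. f i \<oplus>\<^bsub>A\<^esub> g i), mul = (\<lambda>f g. \<lambda>i\<in>I. f i \<odot>\<^bsub>A\<^esub> g i)\<rparr>"

definition subuniverse :: "'a set \<Rightarrow> 'a alg \<Rightarrow> bool" where
  "subuniverse U A \<longleftrightarrow> U \<noteq> {} \<and> U \<subseteq> carrier A \<and>
     (\<forall>x\<in>U. \<forall>y\<in>U. x \<oplus>\<^bsub>A\<^esub> y \<in> U \<and> x \<odot>\<^bsub>A\<^esub> y \<in> U)"

definition surj_hom :: "('a \<Rightarrow> 'b) \<Rightarrow> 'a alg \<Rightarrow> 'b alg \<Rightarrow> bool" where
  "surj_hom h A B \<longleftrightarrow> h ` carrier A = carrier B \<and>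
     (\<forall>x\<in>carrier A. \<forall>y\<in>carrier A.
        h (x \<oplus>\<^bsub>A\<^esub> y) = h x \<oplus>\<^bsub>B\<^esub> h y \<and> h (x \<odot>\<^bsub>A\<^esub> y) = h x \<odot>\<^bsub>B\<^esub> h y)"

text \<open>
  The variety generated by \<open>A\<close> is \<open>HSP(A)\<close>: all homomorphic images of subalgebras of powers of \<open>A\<close>.
  HOL cannot quantify over the type of the index set of the power. Index sets consisting of
  maps from the members' type to that of \<open>A\<close> are enough, as \<open>variety_arbitrary_index\<close> below shows.
\<close>

definition variety :: "'a alg \<Rightarrow> 'b alg set" where
  "variety A = {B. \<exists>(I :: ('b \<Rightarrow> 'a) set) U h.
     subuniverse U (power_alg I A) \<and> surj_hom h ((power_alg I A)\<lparr>carrier := U\<rparr>) B}"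

lemma variety_arbitrary_index:
  fixes A :: "'a alg" and B :: "'b alg" and J :: "'j set"
  assumes U: "subuniverse U (power_alg J A)"
    and h: "surj_hom h ((power_alg J A)\<lparr>carrier := U\<rparr>) B"
  shows "B \<in> variety A"
proof -
  have hU: "h ` U = carrier B" using h by (simp add: surj_hom_def)
  define s where "s = inv_into U h"
  have s: "s b \<in> U" "h (s b) = b" if "b \<in> carrier B" for b
    using that hU by (auto simp: s_def inv_into_into f_inv_into_f)
  define p where "p j = (\<lambda>b. s b j)" for j
  define I where "I = p ` J"
  define r where "r v = (\<lambda>j\<in>J. v (p j))" for v :: "('b \<Rightarrow> 'a) \<Rightarrow> 'a"
  define V where "V = {v \<in> I \<rightarrow>\<^sub>E carrier A. r v \<in> U}"
  have UJ: "U \<subseteq> J \<rightarrow>\<^sub>E carrier A" using U by (simp add: subuniverse_def power_alg_def)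
  have r_add: "r (v \<oplus>\<^bsub>power_alg I A\<^esub> w) = r v \<oplus>\<^bsub>power_alg J A\<^esub> r w"
    and r_mul: "r (v \<odot>\<^bsub>power_alg I A\<^esub> w) = r v \<odot>\<^bsub>power_alg J A\<^esub> r w" for v w
    by (auto simp: r_def power_alg_def I_def restrict_def)
  have lift: "\<exists>v\<in>V. r v = s b" if b: "b \<in> carrier B" for b
  proof -
    have sb: "s b \<in> J \<rightarrow>\<^sub>E carrier A" using s(1)[OF b] UJ by auto
    have eq: "r (\<lambda>f\<in>I. f b) = s b"
      using sb by (auto simp: r_def I_def p_def restrict_def PiE_def extensional_def)
    moreover have "(\<lambda>f\<in>I. f b) \<in> I \<rightarrow>\<^sub>E carrier A"
      using sb by (auto simp: I_def p_def)
    ultimately show ?thesis using s(1)[OF b] unfolding V_def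
      by (intro bexI[of _ "\<lambda>f\<in>I. f b"]) auto
  qed
  have clA: "a \<oplus>\<^bsub>power_alg J A\<^esub> b \<in> U" "a \<odot>\<^bsub>power_alg J A\<^esub> b \<in> U" if "a \<in> U" "b \<in> U" for a b
    using U that by (auto simp: subuniverse_def)
  have cl: "v \<oplus>\<^bsub>power_alg I A\<^esub> w \<in> V" "v \<odot>\<^bsub>power_alg I A\<^esub> w \<in> V"
    if v: "v \<in> V" and w: "w \<in> V" for v w
  proof -
    have ru: "r v \<oplus>\<^bsub>power_alg J A\<^esub> r w \<in> U" "r v \<odot>\<^bsub>power_alg J A\<^esub> r w \<in> U"
      using v w clA by (auto simp: V_def)
    have "r (v \<oplus>\<^bsub>power_alg I A\<^esub> w) \<in> J \<rightarrow>\<^sub>E carrier A" "r (v \<odot>\<^bsub>power_alg I A\<^esub> w) \<in> J \<rightarrow>\<^sub>E carrier A"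
      using ru UJ unfolding r_add r_mul by auto
    then have *: "(v \<oplus>\<^bsub>power_alg I A\<^esub> w) (p j) \<in> carrier A"
      "(v \<odot>\<^bsub>power_alg I A\<^esub> w) (p j) \<in> carrier A" if "j \<in> J" for j
      using that by (auto simp: r_def dest!: PiE_mem[of _ _ _ j])
    have "v \<oplus>\<^bsub>power_alg I A\<^esub> w \<in> extensional I" "v \<odot>\<^bsub>power_alg I A\<^esub> w \<in> extensional I"
      by (simp_all add: power_alg_def)
    then show "v \<oplus>\<^bsub>power_alg I A\<^esub> w \<in> V" "v \<odot>\<^bsub>power_alg I A\<^esub> w \<in> V"
      using * ru unfolding V_def mem_Collect_eq r_add r_mul by (auto simp: PiE_def I_def)
  qed
  obtain u where "u \<in> U" using U by (auto simp: subuniverse_def)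
  then have "carrier B \<noteq> {}" using hU by auto
  then have "V \<noteq> {}" using lift by blast
  then have "subuniverse V (power_alg I A)"
    using cl by (auto simp: subuniverse_def V_def power_alg_def)
  moreover have "surj_hom (h \<circ> r) ((power_alg I A)\<lparr>carrier := V\<rparr>) B"
  proof -
    have "h (r v) \<in> carrier B" if "v \<in> V" for v
      using that hU by (auto simp: V_def)
    moreover have "b \<in> (h \<circ> r) ` V" if "b \<in> carrier B" for b
      using lift[OF that] s(2)[OF that] by force
    ultimately have "(h \<circ> r) ` V = carrier B" by auto
    then show ?thesis using h by (auto simp: surj_hom_def V_def r_add r_mul)
  qed
  ultimately show ?thesis unfolding variety_def by blast
qed

datatype s7 = Zero7 | A7 | One7

instantiation s7 :: "{comm_monoid_mult, mult_zero}"
begin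

definition zero_s7 :: s7 where "0 = Zero7"

definition one_s7 :: s7 where "1 = One7"

fun times_s7 :: "s7 \<Rightarrow> s7 \<Rightarrow> s7" where
  "One7 * x = x"
| "x * One7 = x"
| "_ * _ = Zero7"

instance
proof
  fix x y z :: s7
  show "x * y * z = x * (y * z)" by (cases x; cases y; cases z) simp_all
  show "x * y = y * x" by (cases x; cases y) simp_all
  show "1 * x = x" by (simp add: one_s7_def)
  show "0 * x = 0" "x * 0 = 0" by (cases x; simp add: zero_s7_def)+
qed

end

end

theory Submission
  imports Defs "HOL-Library.Multiset" "HOL-Library.Countable_Set"
begin

text \<open>
  Write \<open>E\<^sub>i = x\<^sub>i x\<^sub>i x\<^sub>i\<^sub>-\<^sub>1 x\<^sub>i\<^sub>+\<^sub>1\<close> with indices modulo \<open>n\<close>. The identity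
  \<open>E\<^sub>0 + \<dots> + E\<^sub>n\<^sub>-\<^sub>1 + x\<^sub>0 \<cdots> x\<^sub>n\<^sub>-\<^sub>1 = E\<^sub>0 + \<dots> + E\<^sub>n\<^sub>-\<^sub>1\<close> holds in \<open>\<P>(S\<^sub>7)\<close>: a product of
  elements of \<open>S\<^sub>7\<close> is \<open>1\<close>, or \<open>0\<close>, or has a single factor \<open>a\<close>, and some \<open>E\<^sub>i\<close> takes the same value.
  It fails in the quotient of the semiring of sets of commutative words by the syntactic congruence of
  the language \<open>L\<close> of the words \<open>x\<^sub>i\<^sup>k x\<^sub>i\<^sub>-\<^sub>1 x\<^sub>i\<^sub>+\<^sub>1\<close> with \<open>k \<ge> 2\<close>. But that quotient satisfies
  every identity of \<open>\<P>(S\<^sub>7)\<close> that is short compared with \<open>n\<close>: if a word outside \<open>L\<close> is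
  indistinguishable from \<open>L\<close> by substitutions into \<open>S\<^sub>7\<close>, then it contains all \<open>n\<close> letters.
\<close>

section \<open>Homomorphic images and identities\<close>

lemma eval_in_carrier:
  assumes "\<And>x y. \<lbrakk>x \<in> carrier S; y \<in> carrier S\<rbrakk> \<Longrightarrow>
      x \<oplus>\<^bsub>S\<^esub> y \<in> carrier S \<and> x \<odot>\<^bsub>S\<^esub> y \<in> carrier S"
    and "range \<rho> \<subseteq> carrier S"
  shows "eval S \<rho> t \<in> carrier S"
  using assms by (induction t) auto

lemma eval_surj_hom:
  assumes "surj_hom h A B"
    and "\<And>x y. \<lbrakk>x \<in> carrier A; y \<in> carrier A\<rbrakk> \<Longrightarrow>
      x \<oplus>\<^bsub>A\<^esub> y \<in> carrier A \<and> x \<odot>\<^bsub>A\<^esub> y \<in> carrier A"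
    and "range \<rho> \<subseteq> carrier A"
  shows "h (eval A \<rho> t) = eval B (h \<circ> \<rho>) t"
proof (induction t)
  case (Add s t)
  then show ?case
    using assms(1) eval_in_carrier[OF assms(2,3), of s] eval_in_carrier[OF assms(2,3), of t]
    by (simp add: surj_hom_def)
next
  case (Mul s t)
  then show ?case
    using assms(1) eval_in_carrier[OF assms(2,3), of s] eval_in_carrier[OF assms(2,3), of t]
    by (simp add: surj_hom_def)
qed simp

lemma surj_hom_lift_assignment:
  assumes "surj_hom h A B" "range \<rho> \<subseteq> carrier B"
  obtains \<rho>' where "range \<rho>' \<subseteq> carrier A" "h \<circ> \<rho>' = \<rho>"
proof -
  have "h ` carrier A = carrier B" using assms(1) unfolding surj_hom_def by blast
  then have "\<rho> n \<in> h ` carrier A" for n using assms(2) by auto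
  then have "\<forall>n. \<exists>x\<in>carrier A. h x = \<rho> n" by (metis imageE)
  then obtain \<rho>' where "\<forall>n. \<rho>' n \<in> carrier A \<and> h (\<rho>' n) = \<rho> n" by metis
  then show thesis by (intro that[of \<rho>']) auto
qed

lemma variety_satisfies:
  assumes "satisfies A e" "B \<in> variety A"
  shows "satisfies B e"
proof -
  obtain I :: "('b \<Rightarrow> 'a) set" and U h
    where U: "subuniverse U (power_alg I A)"
      and h: "surj_hom h ((power_alg I A)\<lparr>carrier := U\<rparr>) B"
    using assms(2) unfolding variety_def by blast
  let ?P = "(power_alg I A)\<lparr>carrier := U\<rparr>"
  have closed: "x \<oplus>\<^bsub>?P\<^esub> y \<in> carrier ?P \<and> x \<odot>\<^bsub>?P\<^esub> y \<in> carrier ?P"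
    if "x \<in> carrier ?P" "y \<in> carrier ?P" for x y
    using that U by (auto simp: subuniverse_def)
  have UA: "U \<subseteq> I \<rightarrow>\<^sub>E carrier A" using U by (simp add: subuniverse_def power_alg_def)
  \<comment> \<open>Operations in a power act coordinatewise, so an identity of \<open>A\<close> can
    be checked one index at a time.\<close>
  have coord: "eval ?P \<rho> t i = eval A (\<lambda>x. \<rho> x i) t" if "i \<in> I" for \<rho> t i
    using that by (induction t) (simp_all add: power_alg_def)
  have "eval B \<rho> (fst e) = eval B \<rho> (snd e)" if \<rho>: "range \<rho> \<subseteq> carrier B" for \<rho>
  proof -
    obtain \<rho>' where \<rho>': "range \<rho>' \<subseteq> carrier ?P" "h \<circ> \<rho>' = \<rho>"
      using surj_hom_lift_assignment[OF h \<rho>] by blast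
    have "eval ?P \<rho>' (fst e) i = eval ?P \<rho>' (snd e) i" if i: "i \<in> I" for i
    proof -
      have "range (\<lambda>x. \<rho>' x i) \<subseteq> carrier A" using \<rho>'(1) UA i by auto
      then show ?thesis using assms(1) coord[OF i] by (simp add: satisfies_def)
    qed
    moreover have "eval ?P \<rho>' t \<in> I \<rightarrow>\<^sub>E carrier A" for t
      using eval_in_carrier[OF closed \<rho>'(1), of t] UA by auto
    ultimately have "eval ?P \<rho>' (fst e) = eval ?P \<rho>' (snd e)" by (meson PiE_ext)
    then show ?thesis
      using eval_surj_hom[OF h closed \<rho>'(1)] \<rho>'(2) by metis
  qed
  then show ?thesis by (simp add: satisfies_def)
qed

lemma ai_semiring_surj_hom:
  assumes "ai_semiring A" "surj_hom h A B"
  shows "ai_semiring B"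
proof -
  interpret A: ai_semiring A by fact
  have onto: "carrier B = h ` carrier A"
    and hom: "\<And>x y. \<lbrakk>x \<in> carrier A; y \<in> carrier A\<rbrakk> \<Longrightarrow> h x \<oplus>\<^bsub>B\<^esub> h y = h (x \<oplus>\<^bsub>A\<^esub> y)"
      "\<And>x y. \<lbrakk>x \<in> carrier A; y \<in> carrier A\<rbrakk> \<Longrightarrow> h x \<odot>\<^bsub>B\<^esub> h y = h (x \<odot>\<^bsub>A\<^esub> y)"
    using assms(2) by (auto simp: surj_hom_def)
  note [simp] = hom A.add_closed A.mul_closed
  show ?thesis
    by unfold_locales
      (auto simp: onto A.nonempty A.add_assoc A.add_idem A.mul_assoc A.distrib_left A.distrib_right
        intro!: arg_cong[where f = h] intro: A.add_commute)
qed

text \<open>The map \<open>q\<close> names the classes of a congruence by elements of the type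
  \<open>'b\<close>. The operations on names are computed through representatives, so the quotient
  lives on whatever type supplies the names.\<close>

lemma quotient_ai_semiring:
  fixes q :: "'a \<Rightarrow> 'b"
  assumes "ai_semiring A"
    and add_cong: "\<And>x x' y y'. \<lbrakk>x \<in> carrier A; x' \<in> carrier A; y \<in> carrier A; y' \<in> carrier A;
      q x = q x'; q y = q y'\<rbrakk> \<Longrightarrow> q (x \<oplus>\<^bsub>A\<^esub> y) = q (x' \<oplus>\<^bsub>A\<^esub> y')"
    and mul_cong: "\<And>x x' y y'. \<lbrakk>x \<in> carrier A; x' \<in> carrier A; y \<in> carrier A; y' \<in> carrier A;
      q x = q x'; q y = q y'\<rbrakk> \<Longrightarrow> q (x \<odot>\<^bsub>A\<^esub> y) = q (x' \<odot>\<^bsub>A\<^esub> y')"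
  obtains B where "ai_semiring B" "surj_hom q A B"
proof -
  define r where "r = inv_into (carrier A) q"
  have r: "r (q x) \<in> carrier A" "q (r (q x)) = q x" if "x \<in> carrier A" for x
    using that by (auto simp: r_def inv_into_into f_inv_into_f)
  define B where "B = \<lparr>carrier = q ` carrier A, add = \<lambda>x y. q (r x \<oplus>\<^bsub>A\<^esub> r y),
    mul = \<lambda>x y. q (r x \<odot>\<^bsub>A\<^esub> r y)\<rparr>"
  have "surj_hom q A B"
    by (auto simp: surj_hom_def B_def r intro!: add_cong mul_cong)
  with ai_semiring_surj_hom[OF assms(1)] show thesis using that by blast
qed

text \<open>Up to isomorphism \<open>A\<close> is its own power over a one-element index set.
  Together with an injective \<open>h\<close> this places a copy of \<open>A\<close> on another type
  inside the variety.\<close>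

lemma variety_isomorphic_copy:
  assumes "ai_semiring A" "surj_hom h A B"
  shows "B \<in> variety A"
proof (rule variety_arbitrary_index)
  interpret A: ai_semiring A by fact
  let ?P = "power_alg (UNIV :: unit set) A"
  show "subuniverse (carrier ?P) ?P"
    using A.nonempty A.add_closed A.mul_closed
    by (auto simp: subuniverse_def power_alg_def PiE_def Pi_def)
  have "(\<lambda>f. h (f ())) ` carrier ?P = h ` carrier A"
  proof
    show "h ` carrier A \<subseteq> (\<lambda>f. h (f ())) ` carrier ?P"
    proof
      fix y assume "y \<in> h ` carrier A"
      then obtain x where "x \<in> carrier A" "y = h x" by blast
      then show "y \<in> (\<lambda>f. h (f ())) ` carrier ?P"
        by (intro image_eqI[of _ _ "\<lambda>_. x"]) (auto simp: power_alg_def)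
    qed
  qed (auto simp: power_alg_def)
  then show "surj_hom (\<lambda>f. h (f ())) (?P\<lparr>carrier := carrier ?P\<rparr>) B"
    using assms(2) by (auto simp: surj_hom_def power_alg_def PiE_def Pi_def)
qed

section \<open>Sets of words\<close>

text \<open>For multisets this is the semiring of sets of commutative words: a word is the multiset
  of its letters, and concatenation is the sum of multisets.\<close>

definition sumset_alg :: "'m::ab_semigroup_add set alg" where
  "sumset_alg = \<lparr>carrier = UNIV, add = (\<union>), mul = (+)\<rparr>"

lemma sumset_alg_simps [simp]:
  "A \<oplus>\<^bsub>sumset_alg\<^esub> B = A \<union> B" "A \<odot>\<^bsub>sumset_alg\<^esub> B = A + B"
  by (simp_all add: sumset_alg_def)

lemma power_semiring_simps [simp]:
  "A \<oplus>\<^bsub>power_semiring\<^esub> B = A \<union> B" "A \<odot>\<^bsub>power_semiring\<^esub> B = A * B"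
  "carrier power_semiring = UNIV"
  by (simp_all add: power_semiring_def)

lemma image_eval_sumset:
  assumes "\<And>a b. h (a + b) = h a + h b"
  shows "h ` eval sumset_alg \<rho> t = eval sumset_alg (\<lambda>x. h ` \<rho> x) t"
proof (induction t)
  case (Mul s t)
  have "h ` (A + B) = h ` A + h ` B" for A B
    by (force simp: set_plus_def assms)
  with Mul show ?case by simp
qed (simp_all add: image_Un)

lemma image_eval_sumset_power:
  assumes "\<And>a b. h (a + b) = h a * h b"
  shows "h ` eval sumset_alg \<rho> t = eval power_semiring (\<lambda>x. h ` \<rho> x) t"
proof (induction t)
  case (Mul s t)
  have "h ` (A + B) = h ` A * h ` B" for A B
    by (force simp: set_plus_def set_times_def assms)
  with Mul show ?case by simp
qed (simp_all add: image_Un)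

section \<open>Traces: the multisets of words chosen for the variable occurrences\<close>

text \<open>Evaluating with singletons \<open>{#\<phi>#}\<close> leaves every chosen word visible in
  the result. A trace with entries in \<open>V\<close> therefore comes from choices in
  \<open>V\<close>; the next lemma is the converse.\<close>

lemma trace_restrict:
  assumes "\<tau> \<in> eval sumset_alg (\<lambda>x. (\<lambda>\<phi>. {#\<phi>#}) ` \<rho> x) s" "set_mset \<tau> \<subseteq> V"
  shows "\<tau> \<in> eval sumset_alg (\<lambda>x. (\<lambda>\<phi>. {#\<phi>#}) ` (\<rho> x \<inter> V)) s"
  using assms
proof (induction s arbitrary: \<tau>)
  case (Mul s t)
  then obtain a b where "a \<in> eval sumset_alg (\<lambda>x. (\<lambda>\<phi>. {#\<phi>#}) ` \<rho> x) s"
      "b \<in> eval sumset_alg (\<lambda>x. (\<lambda>\<phi>. {#\<phi>#}) ` \<rho> x) t" "\<tau> = a + b"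
    by (auto elim: set_plus_elim)
  with Mul show ?case by (auto intro!: set_plus_intro)
qed auto

lemma trace_subset:
  assumes "\<tau> \<in> eval sumset_alg (\<lambda>x. (\<lambda>\<phi>. {#\<phi>#}) ` (\<rho> x \<inter> V)) s"
  shows "\<tau> \<in> eval sumset_alg (\<lambda>x. (\<lambda>\<phi>. {#\<phi>#}) ` \<rho> x) s" "set_mset \<tau> \<subseteq> V"
proof -
  have "\<tau> \<in> eval sumset_alg (\<lambda>x. (\<lambda>\<phi>. {#\<phi>#}) ` \<rho> x) s \<and> set_mset \<tau> \<subseteq> V"
    using assms
  proof (induction s arbitrary: \<tau>)
    case (Mul s t)
    then obtain a b where "a \<in> eval sumset_alg (\<lambda>x. (\<lambda>\<phi>. {#\<phi>#}) ` (\<rho> x \<inter> V)) s"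
        "b \<in> eval sumset_alg (\<lambda>x. (\<lambda>\<phi>. {#\<phi>#}) ` (\<rho> x \<inter> V)) t" "\<tau> = a + b"
      by (auto elim: set_plus_elim)
    with Mul.IH show ?case by (auto intro!: set_plus_intro)
  qed auto
  then show "\<tau> \<in> eval sumset_alg (\<lambda>x. (\<lambda>\<phi>. {#\<phi>#}) ` \<rho> x) s" "set_mset \<tau> \<subseteq> V" by auto
qed

text \<open>A product adds one to the size of a term. This pays for the second \<open>+ 1\<close>
  when the bounds of the two factors are added.\<close>

lemma trace_size:
  assumes "\<tau> \<in> eval sumset_alg (\<lambda>x. (\<lambda>\<phi>. {#\<phi>#}) ` \<rho> x) s"
  shows "size \<tau> \<le> size s + 1"
  using assms
proof (induction s arbitrary: \<tau>)
  case (Mul s t)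
  then obtain a b where "a \<in> eval sumset_alg (\<lambda>x. (\<lambda>\<phi>. {#\<phi>#}) ` \<rho> x) s"
      "b \<in> eval sumset_alg (\<lambda>x. (\<lambda>\<phi>. {#\<phi>#}) ` \<rho> x) t" "\<tau> = a + b"
    by (auto elim: set_plus_elim)
  with Mul.IH(1)[of a] Mul.IH(2)[of b] show ?case by simp
next
  case (Add s t)
  from Add.prems Add.IH[of \<tau>] show ?case by auto
qed auto

text \<open>Each chosen word is treated as a single letter and read in the monoid through
  \<open>h\<close>. The identity is applied to the sets of readings of the words that occur in
  \<open>\<tau>\<close>, so the matching trace on the other side uses no new words.\<close>

lemma trace_transfer:
  fixes h :: "'a \<Rightarrow> 's::comm_monoid_mult"
  assumes "satisfies (power_semiring :: 's set alg) (s, t)"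
    and "\<tau> \<in> eval sumset_alg (\<lambda>x. (\<lambda>\<phi>. {#\<phi>#}) ` \<rho> x) s"
  obtains \<tau>' where "\<tau>' \<in> eval sumset_alg (\<lambda>x. (\<lambda>\<phi>. {#\<phi>#}) ` \<rho> x) t"
    "set_mset \<tau>' \<subseteq> set_mset \<tau>"
    "prod_mset (image_mset h \<tau>') = prod_mset (image_mset h \<tau>)"
proof -
  \<comment> \<open>Some of these intersections may be empty; this is harmless because the empty set
    belongs to the power semiring.\<close>
  let ?R = "\<lambda>x. (\<lambda>\<phi>. {#\<phi>#}) ` (\<rho> x \<inter> set_mset \<tau>)"
  let ?h = "\<lambda>\<sigma>. prod_mset (image_mset h \<sigma>)"
  have image: "?h ` eval sumset_alg ?R r = eval power_semiring (\<lambda>x. ?h ` ?R x) r" for r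
    by (rule image_eval_sumset_power) simp
  have "?h \<tau> \<in> ?h ` eval sumset_alg ?R s"
    using trace_restrict[OF assms(2)] by blast
  also have "\<dots> = ?h ` eval sumset_alg ?R t"
    using assms(1) unfolding image by (simp add: satisfies_def)
  finally obtain \<tau>' where "\<tau>' \<in> eval sumset_alg ?R t" "?h \<tau>' = ?h \<tau>" by fastforce
  then show thesis using trace_subset[of \<tau>' \<rho> "set_mset \<tau>" t] by (intro that[of \<tau>']) auto
qed

section \<open>Cyclic words\<close>

text \<open>This is the language \<open>L\<close> over the letters from 0 to \<open>n - 1\<close>,
  for positive \<open>n\<close>. The index \<open>i\<close> is any integer, and reduction modulo
  \<open>n\<close> closes the cycle.\<close>

definition cyclic_words :: "int \<Rightarrow> int multiset set" where
  "cyclic_words n = {u. \<exists>i. 2 \<le> count u (i mod n) \<and> count u ((i - 1) mod n) = 1 \<and>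
     count u ((i + 1) mod n) = 1 \<and> set_mset u = {(i - 1) mod n, i mod n, (i + 1) mod n}}"

section \<open>Detecting letters by readings in \<open>S\<^sub>7\<close>\<close>

lemma s7_neq [simp]: "(1::s7) \<noteq> Zero7" "(1::s7) \<noteq> A7"
  by (simp_all add: one_s7_def)

lemma Zero7_times [simp]: "Zero7 * x = Zero7" "x * Zero7 = Zero7"
  by (cases x; simp)+

lemma s7_mult_self [simp]: "x \<noteq> 1 \<Longrightarrow> x * x = Zero7"
  by (cases x) (simp_all add: one_s7_def)

lemma A7_power: "A7 ^ k = (if k = 0 then 1 else if k = 1 then A7 else Zero7)"
  by (induction k) auto

lemma A7_power_ge_2:
  assumes "A7 ^ j = A7 ^ k" "2 \<le> k"
  shows "2 \<le> j"
proof -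
  have "A7 ^ j = Zero7" using assms by (simp add: A7_power)
  then have "j \<noteq> 0" "j \<noteq> 1" by (auto simp: A7_power split: if_splits)
  then show ?thesis by linarith
qed

text \<open>As the powers of \<open>A7\<close> tell apart just the exponents 0, 1 and at least 2,
  this reading counts the letters with property \<open>P\<close> up to the threshold two.\<close>

lemma prod_mset_A7:
  "prod_mset (image_mset (\<lambda>y. if P y then A7 else 1) u) = A7 ^ size (filter_mset P u)"
  by (induction u) auto

lemma prod_mset_Zero7_iff:
  "prod_mset (image_mset (\<lambda>y. if y = x then Zero7 else 1) u) = Zero7 \<longleftrightarrow> x \<in># u"
  by (induction u) auto

text \<open>Readings that send one or two letters to \<open>A7\<close> show which letters are
  simple, which are repeated, and how two letters of \<open>u\<close> lie in triples of neighbours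
  contained in \<open>u\<close>. The missing letter \<open>z\<close> is essential: the product of
  all \<open>n\<close> letters also passes every reading.\<close>

lemma cyclic_words_closed:
  fixes n :: int
  assumes n: "n \<ge> 3"
    and transfer: "\<And>g :: int \<Rightarrow> s7. \<exists>u'\<in>cyclic_words n. set_mset u' \<subseteq> set_mset u \<and>
      prod_mset (image_mset g u') = prod_mset (image_mset g u)"
    and z: "0 \<le> z" "z < n" "z \<notin># u"
  shows "u \<in> cyclic_words n"
proof -
  \<comment> \<open>The triples of neighbours inside \<open>u\<close>, i.e. the possible supports of
    the cyclic words supplied by \<open>transfer\<close>.\<close>
  define H where "H i \<longleftrightarrow> {(i - 1) mod n, i mod n, (i + 1) mod n} \<subseteq> set_mset u" for i
  have transfer': "\<exists>i u'. H i \<and> 2 \<le> count u' (i mod n) \<and> count u' ((i - 1) mod n) = 1 \<and>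
     count u' ((i + 1) mod n) = 1 \<and> set_mset u' = {(i - 1) mod n, i mod n, (i + 1) mod n} \<and>
     A7 ^ size (filter_mset P u') = A7 ^ size (filter_mset P u)" for P
    using transfer[of "\<lambda>y. if P y then A7 else 1"]
    unfolding cyclic_words_def H_def prod_mset_A7 by fastforce
  have single: "size (filter_mset (\<lambda>y. y = x) v) = count v x" for x :: int and v
    by (induction v) auto
  \<comment> \<open>A simple letter stays simple in \<open>u'\<close>, so it is an outer letter of
    the triple and not the repeated middle one. Dually, \<open>b\<close> makes every repeated letter
    a middle one.\<close>
  have a: "\<exists>i. H i \<and> (x = (i - 1) mod n \<or> x = (i + 1) mod n)" if x: "count u x = 1" for x
  proof -
    obtain i u' where "H i" "set_mset u' = {(i - 1) mod n, i mod n, (i + 1) mod n}"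
      "2 \<le> count u' (i mod n)" "A7 ^ count u' x = A7 ^ count u x"
      using transfer'[of "\<lambda>y. y = x"] unfolding single by blast
    moreover have "count u' x = 1"
      using calculation(4) x by (auto simp: A7_power split: if_splits)
    moreover have "x \<in># u'" using calculation(5) by (simp add: count_inI)
    ultimately show ?thesis by auto
  qed
  have b: "\<exists>i. H i \<and> x = i mod n" if x: "2 \<le> count u x" for x
  proof -
    obtain i u' where *: "H i" "set_mset u' = {(i - 1) mod n, i mod n, (i + 1) mod n}"
      "count u' ((i - 1) mod n) = 1" "count u' ((i + 1) mod n) = 1"
      "A7 ^ count u' x = A7 ^ count u x"
      using transfer'[of "\<lambda>y. y = x"] unfolding single by blast
    have "2 \<le> count u' x"
      using *(5) x by (rule A7_power_ge_2)
    moreover from this have "x \<in># u'" by (auto intro: count_inI)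
    ultimately show ?thesis using * by auto
  qed
  have pair: "size (filter_mset (\<lambda>w. w = x \<or> w = y) v) = count v x + count v y"
    if "x \<noteq> y" for x y :: int and v
    using that by (induction v) auto
  \<comment> \<open>Two letters of \<open>u\<close> are read together as \<open>Zero7\<close>. Hence
    \<open>u'\<close> contains both of them or repeats one of them, and only the middle letter is
    repeated.\<close>
  have c: "\<exists>i. H i \<and> (x = i mod n \<or> y = i mod n \<or>
      x = (i - 1) mod n \<and> y = (i + 1) mod n \<or> x = (i + 1) mod n \<and> y = (i - 1) mod n)"
    if xy: "x \<in># u" "y \<in># u" "x \<noteq> y" for x y
  proof -
    obtain i u' where *: "H i" "set_mset u' = {(i - 1) mod n, i mod n, (i + 1) mod n}"
      "count u' ((i - 1) mod n) = 1" "count u' ((i + 1) mod n) = 1"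
      "A7 ^ (count u' x + count u' y) = A7 ^ (count u x + count u y)"
      using transfer'[of "\<lambda>w. w = x \<or> w = y"] unfolding pair[OF xy(3)] by blast
    have "2 \<le> count u x + count u y"
      using xy(1,2) count_greater_zero_iff[of u x] count_greater_zero_iff[of u y] by linarith
    with *(5) have "2 \<le> count u' x + count u' y" by (rule A7_power_ge_2)
    then have "x \<in># u' \<and> y \<in># u' \<or> 2 \<le> count u' x \<or> 2 \<le> count u' y"
      using count_greater_zero_iff[of u' x] count_greater_zero_iff[of u' y] by linarith
    moreover have "w \<in># u'" if "2 \<le> count u' w" for w using that by (auto intro: count_inI)
    moreover have "w = i mod n" if "2 \<le> count u' w" for w
      using that *(2-4) \<open>\<And>w. 2 \<le> count u' w \<Longrightarrow> w \<in># u'\<close>[OF that] by auto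
    ultimately consider "x \<in># u'" "y \<in># u'" | "x = i mod n" | "y = i mod n" by blast
    then show ?thesis
    proof cases
      case 1
      then show ?thesis unfolding *(2) using *(1) xy(3) by (intro exI[of _ i]) auto
    qed (use *(1) in blast)+
  qed
  have inj: "j = k" if "(z + j) mod n = (z + k) mod n" "0 \<le> j" "j < n" "0 \<le> k" "k < n" for j k
    using that
    by (metis mod_pos_pos_trivial add.commute add_diff_cancel_right' mod_diff_left_eq)
  text \<open>Cutting the cycle at the missing letter \<open>z\<close> makes the indices a linear order.\<close>
  define T where "T = {j. 0 \<le> j \<and> j < n \<and> H (z + j)}"
  \<comment> \<open>None of the three letters of a triple is \<open>z\<close>, so a position and
    both of its neighbours stay between 1 and \<open>n - 1\<close>, where \<open>inj\<close>
    applies.\<close>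
  have T_range: "2 \<le> j \<and> j \<le> n - 2" if "j \<in> T" for j
  proof -
    have j: "0 \<le> j" "j < n" "(z + j - 1) mod n \<noteq> z" "(z + j) mod n \<noteq> z" "(z + j + 1) mod n \<noteq> z"
      using that z by (auto simp: T_def H_def)
    have "j \<noteq> 0" "j \<noteq> 1" "j \<noteq> n - 1" using j z by auto
    then show ?thesis using j by linarith
  qed
  have norm: "\<exists>j\<in>T. i mod n = (z + j) mod n \<and> (i + 1) mod n = (z + (j + 1)) mod n \<and>
      (i - 1) mod n = (z + (j - 1)) mod n" if "H i" for i
  proof -
    \<comment> \<open>The position of \<open>i\<close> counted from the cut at
      \<open>z\<close>.\<close>
    define j where "j = (i - z) mod n"
    have e: "(z + j + k) mod n = (i + k) mod n" for k
      unfolding j_def by (metis add.assoc add.commute diff_add_cancel mod_add_left_eq)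
    have "H (z + j)" using that e[of "-1"] e[of 0] e[of 1] by (simp add: H_def)
    then have "j \<in> T" using n by (simp add: T_def j_def)
    then show ?thesis
      using e[of "-1"] e[of 0] e[of 1] by (intro bexI[of _ j]) (simp_all add: algebra_simps)
  qed
  have "\<exists>i. H i" using transfer' by blast
  then have "T \<noteq> {}" using norm by blast
  moreover have finT: "finite T"
    by (rule finite_subset[of _ "{0..n}"]) (auto simp: T_def)
  ultimately have M: "Max T \<in> T" "Min T \<in> T" "Min T \<le> Max T" by auto
  define a where "a = Min T"
  define b where "b = Max T"
  have ab: "a \<in> T" "b \<in> T" "a \<le> b" and bounds: "\<And>j. j \<in> T \<Longrightarrow> a \<le> j \<and> j \<le> b"
    using M finT by (auto simp: a_def b_def)
  have r: "2 \<le> a" "b \<le> n - 2" using T_range ab by auto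
  \<comment> \<open>The two outermost letters of all triples are tested with \<open>c\<close>. The
    resulting triple has its middle position \<open>j\<close> between \<open>a\<close> and
    \<open>b\<close>, which leaves only the case where they are its two outer letters; then
    \<open>a = j = b\<close>.\<close>
  have "(z + (a - 1)) mod n \<in># u" "(z + (b + 1)) mod n \<in># u"
    using ab by (auto simp: T_def H_def algebra_simps)
  moreover have "(z + (a - 1)) mod n \<noteq> (z + (b + 1)) mod n"
    using inj[of "a - 1" "b + 1"] r ab(3) by auto
  ultimately obtain i where "H i" and "(z + (a - 1)) mod n = i mod n \<or> (z + (b + 1)) mod n = i mod n \<or>
      (z + (a - 1)) mod n = (i - 1) mod n \<and> (z + (b + 1)) mod n = (i + 1) mod n \<or>
      (z + (a - 1)) mod n = (i + 1) mod n \<and> (z + (b + 1)) mod n = (i - 1) mod n"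
    using c by blast
  with norm obtain j where j: "j \<in> T" and
    "(z + (a - 1)) mod n = (z + j) mod n \<or> (z + (b + 1)) mod n = (z + j) mod n \<or>
      (z + (a - 1)) mod n = (z + (j - 1)) mod n \<and> (z + (b + 1)) mod n = (z + (j + 1)) mod n \<or>
      (z + (a - 1)) mod n = (z + (j + 1)) mod n \<and> (z + (b + 1)) mod n = (z + (j - 1)) mod n"
    by metis
  then have "a - 1 = j \<or> b + 1 = j \<or> a - 1 = j - 1 \<and> b + 1 = j + 1 \<or> a - 1 = j + 1 \<and> b + 1 = j - 1"
    using inj r ab(3) bounds[OF j] by (smt (verit))
  then have "a = j" "b = j" using bounds[OF j] by auto
  then have T1: "k = j" if "k \<in> T" for k using bounds[OF that] by auto
  have jr: "2 \<le> j" "j \<le> n - 2" using T_range j by auto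
  \<comment> \<open>With a single triple left, \<open>a\<close> and \<open>b\<close> determine every
    letter of \<open>u\<close> and whether it is repeated.\<close>
  have head: "x = (z + j) mod n" if "2 \<le> count u x" for x
    using b[OF that] norm T1 by metis
  have tail: "x = (z + (j - 1)) mod n \<or> x = (z + (j + 1)) mod n" if "count u x = 1" for x
    using a[OF that] norm T1 by metis
  have Hj: "H (z + j)" using j by (simp add: T_def)
  have mem: "(z + (j - 1)) mod n \<in># u" "(z + j) mod n \<in># u" "(z + (j + 1)) mod n \<in># u"
    using Hj by (auto simp: H_def algebra_simps)
  have dist: "(z + (j - 1)) mod n \<noteq> (z + j) mod n" "(z + (j + 1)) mod n \<noteq> (z + j) mod n"
    using inj[of "j - 1" j] inj[of "j + 1" j] jr by auto
  have count_cases: "count u x = 1 \<or> 2 \<le> count u x" if "x \<in># u" for x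
    using that count_greater_zero_iff[of u x] by linarith
  have "2 \<le> count u ((z + j) mod n)" using count_cases[OF mem(2)] tail dist by metis
  moreover have "count u ((z + (j - 1)) mod n) = 1" "count u ((z + (j + 1)) mod n) = 1"
    using count_cases mem head dist by metis+
  moreover have "set_mset u = {(z + (j - 1)) mod n, (z + j) mod n, (z + (j + 1)) mod n}"
    using count_cases head tail mem by blast
  ultimately show ?thesis
    unfolding cyclic_words_def by (intro CollectI exI[of _ "z + j"]) (simp add: algebra_simps)
qed

text \<open>
  A trace records the words chosen for the variable occurrences. Each of them is a factor of a
  cyclic word, so the result involves few letters and misses one.
\<close>

lemma cyclic_words_identity:
  assumes sat: "satisfies (power_semiring :: s7 set alg) (s, t)"
    and n: "3 * int (size s) + 6 < n"
    and t: "\<And>v. v \<in> eval sumset_alg \<rho> t \<Longrightarrow> p + v \<in> cyclic_words n"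
    and v: "v \<in> eval sumset_alg \<rho> s"
  shows "p + v \<in> cyclic_words n"
proof -
  let ?tr = "\<lambda>r. eval sumset_alg (\<lambda>x. (\<lambda>\<phi>. {#\<phi>#}) ` \<rho> x) r"
  have sum_trace: "sum_mset ` ?tr r = eval sumset_alg \<rho> r" for r
    by (subst image_eval_sumset) (simp_all add: image_image)
  obtain \<tau> where \<tau>: "\<tau> \<in> ?tr s" "v = sum_mset \<tau>"
    using v sum_trace[of s] by blast
  have t': "p + sum_mset \<tau>' \<in> cyclic_words n" if "\<tau>' \<in> ?tr t" for \<tau>'
    using t that sum_trace[of t] by blast
  have card3: "card (set_mset u) \<le> 3" if "u \<in> cyclic_words n" for u
    using that by (auto simp: cyclic_words_def card_insert_if)
  have "card (set_mset p) \<le> 3"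
  proof -
    obtain \<tau>' where "\<tau>' \<in> ?tr t"
      \<comment> \<open>The constant reading serves only to produce some trace of \<open>t\<close>,
        which makes \<open>p\<close> a factor of a cyclic word.\<close>
      using trace_transfer[OF sat \<tau>(1), of "\<lambda>_. 1"] by blast
    from card3[OF t'[OF this]] show ?thesis
      by (meson card_mono finite_set_mset le_trans set_mset_mono mset_subset_eq_add_left)
  qed
  moreover have "card (set_mset \<phi>) \<le> 3" if "\<phi> \<in># \<tau>" for \<phi>
  proof -
    \<comment> \<open>Sending the word \<open>\<phi>\<close> to zero and all others to 1 forces
      \<open>\<phi>\<close> to occur in the new trace as well.\<close>
    obtain \<tau>' where \<tau>': "\<tau>' \<in> ?tr t"
      and "prod_mset (image_mset (\<lambda>\<psi>. if \<psi> = \<phi> then Zero7 else 1) \<tau>') =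
        prod_mset (image_mset (\<lambda>\<psi>. if \<psi> = \<phi> then Zero7 else 1) \<tau>)"
      using trace_transfer[OF sat \<tau>(1)] by blast
    then have "\<phi> \<in># \<tau>'" using that prod_mset_Zero7_iff by metis
    then have "set_mset \<phi> \<subseteq> set_mset (p + sum_mset \<tau>')" by auto
    with card3[OF t'[OF \<tau>']] show ?thesis
      by (meson card_mono finite_set_mset le_trans)
  qed
  then have "(\<Sum>\<phi>\<in>set_mset \<tau>. card (set_mset \<phi>)) \<le> card (set_mset \<tau>) * 3"
    using sum_bounded_above[of "set_mset \<tau>" "\<lambda>\<phi>. card (set_mset \<phi>)" 3] by simp
  moreover have "card (\<Union>\<phi>\<in>set_mset \<tau>. set_mset \<phi>) \<le> (\<Sum>\<phi>\<in>set_mset \<tau>. card (set_mset \<phi>))"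
    by (rule card_UN_le) simp
  moreover have "card (set_mset (p + v)) \<le> card (set_mset p) + card (\<Union>\<phi>\<in>set_mset \<tau>. set_mset \<phi>)"
  proof -
    have "set_mset (p + v) = set_mset p \<union> (\<Union>\<phi>\<in>set_mset \<tau>. set_mset \<phi>)"
      by (auto simp: \<tau>(2))
    then show ?thesis by (simp add: card_Un_le)
  qed
  moreover have "card (set_mset \<tau>) \<le> size s + 1"
    using trace_size[OF \<tau>(1)] size_multiset_overloaded_eq[of \<tau>]
      sum_mono[of "set_mset \<tau>" "\<lambda>_. 1" "count \<tau>"] by (simp add: Suc_le_eq)
  \<comment> \<open>Three letters from \<open>p\<close> and three from each distinct word of the
    trace: at most \<open>3 * size s + 6\<close>, fewer than \<open>n\<close>.\<close>
  ultimately have "card (set_mset (p + v)) \<le> 3 + (size s + 1) * 3"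
    by (meson add_mono mult_le_mono1 order_trans)
  then have "card (set_mset (p + v)) < card {0..<n}" using n by simp
  then obtain z where "z \<in> {0..<n}" "z \<notin># p + v"
    by (meson card_mono finite_set_mset not_le subsetI)
  moreover have "\<exists>u'\<in>cyclic_words n. set_mset u' \<subseteq> set_mset (p + v) \<and>
      prod_mset (image_mset g u') = prod_mset (image_mset g (p + v))" for g :: "int \<Rightarrow> s7"
  proof -
    \<comment> \<open>A reading \<open>g\<close> of letters extends multiplicatively to words, and
      this extension is the reading used for the trace.\<close>
    have prod_sum: "prod_mset (image_mset g (sum_mset \<sigma>)) =
        prod_mset (image_mset (\<lambda>\<phi>. prod_mset (image_mset g \<phi>)) \<sigma>)" for \<sigma>
      by (induction \<sigma>) simp_all
    obtain \<tau>' where \<tau>': "\<tau>' \<in> ?tr t" "set_mset \<tau>' \<subseteq> set_mset \<tau>"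
      "prod_mset (image_mset (\<lambda>\<phi>. prod_mset (image_mset g \<phi>)) \<tau>') =
       prod_mset (image_mset (\<lambda>\<phi>. prod_mset (image_mset g \<phi>)) \<tau>)"
      using trace_transfer[OF sat \<tau>(1)] by blast
    then show ?thesis
      by (intro bexI[OF _ t'[OF \<tau>'(1)]]) (auto simp: \<tau>(2) prod_sum)
  qed
  ultimately show ?thesis
    using n by (intro cyclic_words_closed[of n "p + v" z]) auto
qed

section \<open>The separating identities\<close>

primrec prod_tm :: "nat \<Rightarrow> tm" where
  "prod_tm 0 = Var 0"
| "prod_tm (Suc n) = Mul (prod_tm n) (Var (Suc n))"

primrec sum_tm :: "(nat \<Rightarrow> tm) \<Rightarrow> nat \<Rightarrow> tm" where
  "sum_tm f 0 = f 0"
| "sum_tm f (Suc n) = Add (sum_tm f n) (f (Suc n))"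

text \<open>The word \<open>E\<^sub>i\<close> for a cycle of \<open>Suc N\<close> variables; adding
  \<open>N\<close> is subtracting one modulo \<open>Suc N\<close>.\<close>

definition edge_tm :: "nat \<Rightarrow> nat \<Rightarrow> tm" where
  "edge_tm N i = Mul (Mul (Var i) (Var i))
     (Mul (Var ((i + N) mod Suc N)) (Var (Suc i mod Suc N)))"

lemma eval_sum_tm_power: "eval power_semiring \<rho> (sum_tm f n) = (\<Union>i\<le>n. eval power_semiring \<rho> (f i))"
  by (induction n) (auto simp: atMost_Suc)

lemma eval_sum_tm_sumset: "eval sumset_alg \<rho> (sum_tm f n) = (\<Union>i\<le>n. eval sumset_alg \<rho> (f i))"
  by (induction n) (auto simp: atMost_Suc)

lemma eval_prod_tm_power:
  fixes \<rho> :: "nat \<Rightarrow> 's::comm_monoid_mult set"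
  assumes "x \<in> eval power_semiring \<rho> (prod_tm n)"
  shows "\<exists>c. (\<forall>i\<le>n. c i \<in> \<rho> i) \<and> x = (\<Prod>i\<le>n. c i)"
  using assms
proof (induction n arbitrary: x)
  case 0
  then show ?case by (intro exI[of _ "\<lambda>_. x"]) auto
next
  case (Suc n)
  then obtain y d where y: "y \<in> eval power_semiring \<rho> (prod_tm n)" "d \<in> \<rho> (Suc n)" "x = y * d"
    by (auto simp: set_times_def)
  obtain c where c: "\<forall>i\<le>n. c i \<in> \<rho> i" "y = (\<Prod>i\<le>n. c i)" using Suc.IH[OF y(1)] by blast
  have "(\<Prod>i\<le>Suc n. (c(Suc n := d)) i) = y * d"
    unfolding c(2) prod.atMost_Suc by (auto intro!: arg_cong2[where f = "(*)"] prod.cong)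
  then show ?case using c(1) y by (intro exI[of _ "c(Suc n := d)"]) (auto simp: le_Suc_eq)
qed

lemma s7_prod_cases:
  fixes c :: "'i \<Rightarrow> s7"
  assumes "finite I"
  obtains "\<And>i. i \<in> I \<Longrightarrow> c i = 1" "prod c I = 1"
  | i where "i \<in> I" "c i \<noteq> 1" "prod c I = Zero7"
  | i where "i \<in> I" "c i = A7" "\<And>j. j \<in> I - {i} \<Longrightarrow> c j = 1" "prod c I = A7"
proof (cases "\<forall>i\<in>I. c i = 1")
  case True
  then show thesis using that(1) by simp
next
  case False
  then obtain i where i: "i \<in> I" "c i \<noteq> 1" by blast
  have split: "prod c I = c i * prod c (I - {i})" using assms i(1) by (simp add: prod.remove)
  show thesis
  proof (cases "prod c I = Zero7")
    case True
    then show thesis using that(2) i by blast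
  next
    case nonzero: False
    then have ci: "c i = A7" using split i(2) by (cases "c i") (auto simp: one_s7_def)
    then have rest: "prod c (I - {i}) = 1"
      using split nonzero by (cases "prod c (I - {i})") (auto simp: one_s7_def)
    have "c j = 1" if j: "j \<in> I - {i}" for j
    proof -
      have "c j * prod c (I - {i} - {j}) = 1"
        using rest assms j prod.remove[of "I - {i}" j c] by simp
      then show ?thesis by (cases "c j"; cases "prod c (I - {i} - {j})") (auto simp: one_s7_def)
    qed
    then show thesis using that(3)[of i] i(1) ci split rest by (simp add: one_s7_def)
  qed
qed

text \<open>Value 1: all chosen factors are 1 and any edge has value 1. Value zero: an edge squares
  a factor other than 1. Value \<open>A7\<close>: the edge centred next to the only factor
  \<open>A7\<close> contains that factor once and otherwise only 1.\<close>

lemma separating_identity_holds: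
  assumes N: "N \<ge> 2"
  shows "satisfies (power_semiring :: s7 set alg)
    (Add (sum_tm (edge_tm N) N) (prod_tm N), sum_tm (edge_tm N) N)"
proof -
  have "x \<in> eval power_semiring \<rho> (sum_tm (edge_tm N) N)"
    if x: "x \<in> eval power_semiring \<rho> (prod_tm N)" for x and \<rho> :: "nat \<Rightarrow> s7 set"
  proof -
    obtain c where c: "\<forall>i\<le>N. c i \<in> \<rho> i" "x = (\<Prod>i\<le>N. c i)" using eval_prod_tm_power[OF x] by blast
    have edge: "c i * c i * (c ((i + N) mod Suc N) * c (Suc i mod Suc N)) \<in>
        eval power_semiring \<rho> (sum_tm (edge_tm N) N)" if "i \<le> N" for i
    proof -
      have "(i + N) mod Suc N \<le> N" "Suc i mod Suc N \<le> N"
        using mod_less_divisor[of "Suc N"] by (simp_all only: less_Suc_eq_le)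
      then show ?thesis
        using that c(1) unfolding eval_sum_tm_power
        by (intro UN_I[of i]) (auto simp: edge_tm_def intro!: set_times_intro)
    qed
    show ?thesis
    proof (rule s7_prod_cases[of "{..N}" c])
      assume "\<And>i. i \<in> {..N} \<Longrightarrow> c i = 1" "prod c {..N} = 1"
      then show ?thesis using edge[of 0] N c(2) by simp
    next
      fix i assume "i \<in> {..N}" "c i \<noteq> 1" "prod c {..N} = Zero7"
      then show ?thesis using edge[of i] c(2) by simp
    next
      fix i assume i: "i \<in> {..N}" "c i = A7" and rest: "\<And>j. j \<in> {..N} - {i} \<Longrightarrow> c j = 1"
        and p: "prod c {..N} = A7"
      \<comment> \<open>The edge at the successor of \<open>i\<close> has \<open>i\<close> as its
        left neighbour.\<close>
      define j where "j = Suc i mod Suc N"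
      have j: "j \<le> N" "j \<noteq> i" "(j + N) mod Suc N = i" "Suc j mod Suc N \<le> N" "Suc j mod Suc N \<noteq> i"
      proof -
        have j_if: "j = (if i = N then 0 else Suc i)" using i(1) by (simp add: j_def mod_Suc)
        show "j \<le> N" "j \<noteq> i" "Suc j mod Suc N \<le> N" "Suc j mod Suc N \<noteq> i"
          using i(1) N by (auto simp: j_if mod_Suc)
        have "(Suc i + N) mod Suc N = (i + Suc N) mod Suc N" by simp
        also have "\<dots> = i" using i(1) by (simp only: mod_add_self2) simp
        finally show "(j + N) mod Suc N = i" by (simp add: j_if)
      qed
      have "c j = 1" "c (Suc j mod Suc N) = 1" using rest j by auto
      then show ?thesis using edge[of j] j i(2) c(2) p by simp
    qed simp
  qed
  then show ?thesis by (auto simp: satisfies_def)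
qed

lemma eval_edge_tm_letters:
  assumes N: "N \<ge> 2" and i: "i \<le> N"
  shows "eval sumset_alg (\<lambda>x. {{#int x#}}) (edge_tm N i) \<subseteq> cyclic_words (int (Suc N))"
proof -
  define n where "n = int (Suc N)"
  have mods: "int ((i + N) mod Suc N) = (int i - 1) mod n" "int (Suc i mod Suc N) = (int i + 1) mod n"
    "int i = int i mod n"
  proof -
    have "int ((i + N) mod Suc N) = (int i - 1 + n) mod n" by (simp add: n_def zmod_int)
    then show "int ((i + N) mod Suc N) = (int i - 1) mod n" by (simp only: mod_add_self2)
  qed (use i in \<open>simp_all add: n_def zmod_int add.commute\<close>)
  \<comment> \<open>A cycle of at least three letters is needed for the two neighbours to differ
    from each other.\<close>
  have d: "(i + N) mod Suc N \<noteq> i" "Suc i mod Suc N \<noteq> i" "(i + N) mod Suc N \<noteq> Suc i mod Suc N"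
  proof -
    have "(i + N) mod Suc N = (if i = 0 then N else i - 1)"
      using i by (auto simp: mod_if)
    moreover have "Suc i mod Suc N = (if i = N then 0 else Suc i)" using i by (auto simp: mod_Suc)
    ultimately show "(i + N) mod Suc N \<noteq> i" "Suc i mod Suc N \<noteq> i"
      "(i + N) mod Suc N \<noteq> Suc i mod Suc N" using N i by (auto split: if_splits)
  qed
  define l r where "l = int ((i + N) mod Suc N)" and "r = int (Suc i mod Suc N)"
  have neq: "l \<noteq> int i" "r \<noteq> int i" "l \<noteq> r"
    using d unfolding l_def r_def by (simp_all only: of_nat_eq_iff) auto
  have "eval sumset_alg (\<lambda>x. {{#int x#}}) (edge_tm N i) = {{#int i, int i, l, r#}}"
    by (simp add: edge_tm_def l_def r_def set_plus_def add_mset_commute)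
  moreover have "{#int i, int i, l, r#} \<in> cyclic_words n"
    unfolding cyclic_words_def
    using neq mods[folded l_def r_def]
    by (intro CollectI exI[of _ "int i"]) (simp add: insert_commute)
  ultimately show ?thesis by (simp add: n_def)
qed

lemma eval_prod_tm_letters:
  "eval sumset_alg (\<lambda>x. {{#int x#}}) (prod_tm N) = {image_mset int (mset_set {..N})}"
  by (induction N) (auto simp: set_plus_def atMost_Suc)

text \<open>A cyclic word repeats its middle letter, while here every letter occurs at most
  once.\<close>

lemma prod_word_not_cyclic:
  assumes "N \<ge> 2" "n = int (Suc N)"
  shows "image_mset int (mset_set {..N}) \<notin> cyclic_words n"
proof
  assume "image_mset int (mset_set {..N}) \<in> cyclic_words n"
  then obtain i where "2 \<le> count (image_mset int (mset_set {..N})) i"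
    by (auto simp: cyclic_words_def)
  moreover have "image_mset int (mset_set {..N}) = mset_set (int ` {..N})"
    by (simp add: image_mset_mset_set)
  ultimately show False by (simp add: count_mset_set' split: if_splits)
qed

section \<open>The separating models\<close>

text \<open>Having equal contexts is the syntactic congruence of \<open>L\<close> lifted to sets of
  words; by commutativity, contexts on one side suffice.\<close>

definition contexts :: "'m::ab_semigroup_add set \<Rightarrow> 'm set \<Rightarrow> 'm set" where
  "contexts L X = {p. \<forall>v\<in>X. p + v \<in> L}"

lemma contexts_Un: "contexts L (X \<union> Y) = contexts L X \<inter> contexts L Y"
  by (auto simp: contexts_def)

lemma contexts_plus_cong:
  assumes "contexts L X = contexts L X'" "contexts L Y = contexts L Y'"
  shows "contexts L (X + Y) = contexts L (X' + Y')"
proof -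
  \<comment> \<open>The contexts of a sum depend on \<open>X\<close> only through the contexts of
    \<open>X\<close>. By commutativity the summands can be replaced one after the other.\<close>
  have plus: "contexts L (X + Y) = {p. \<forall>v\<in>Y. p + v \<in> contexts L X}" for X Y
  proof -
    have "p + v + x = p + (x + v)" for p v x :: 'a by (simp add: ac_simps)
    then show ?thesis by (auto simp: contexts_def elim!: set_plus_elim intro: set_plus_intro)
  qed
  have "contexts L (X + Y) = contexts L (Y + X')"
    using assms(1) by (simp add: plus add.commute[of Y])
  also have "\<dots> = contexts L (X' + Y')"
    using assms(2) by (simp add: plus add.commute[of X'])
  finally show ?thesis .
qed

instance tm :: countable
  by countable_datatype

text \<open>A short identity valid in the power semiring gives both sides the same contexts. The
  long one fails when each variable is assigned its own letter.\<close>

lemma separating_model: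
  assumes "infinite (UNIV :: 'b set)" and N: "N \<ge> 2"
  obtains B :: "'b alg" where "ai_semiring B"
    "\<And>s t. \<lbrakk>satisfies (power_semiring :: s7 set alg) (s, t);
       3 * size s + 6 \<le> N; 3 * size t + 6 \<le> N\<rbrakk> \<Longrightarrow> satisfies B (s, t)"
    "\<not> satisfies B (Add (sum_tm (edge_tm N) N) (prod_tm N), sum_tm (edge_tm N) N)"
proof -
  let ?n = "int (Suc N)"
  let ?L = "cyclic_words ?n"
  define \<gamma> :: "nat \<Rightarrow> int multiset set" where "\<gamma> x = {{#int x#}}" for x
  \<comment> \<open>The subalgebra generated by the letters. It is countable because terms are, so
    its quotient fits into any infinite type \<open>'b\<close>.\<close>
  define A where "A = sumset_alg\<lparr>carrier := range (eval sumset_alg \<gamma>)\<rparr>"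
  have eval_A: "eval A = eval sumset_alg"
  proof (intro ext)
    show "eval A \<rho> t = eval sumset_alg \<rho> t" for \<rho> t
      by (induction t) (simp_all add: A_def)
  qed
  have closed: "x \<oplus>\<^bsub>A\<^esub> y \<in> carrier A \<and> x \<odot>\<^bsub>A\<^esub> y \<in> carrier A"
    if xy: "x \<in> carrier A" "y \<in> carrier A" for x y
  proof -
    obtain s t where "x = eval sumset_alg \<gamma> s" "y = eval sumset_alg \<gamma> t"
      using xy by (auto simp: A_def)
    then have "x \<oplus>\<^bsub>A\<^esub> y = eval sumset_alg \<gamma> (Add s t)" "x \<odot>\<^bsub>A\<^esub> y = eval sumset_alg \<gamma> (Mul s t)"
      by (simp_all add: A_def)
    moreover have "carrier A = range (eval sumset_alg \<gamma>)" by (simp add: A_def)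
    ultimately show ?thesis by (metis rangeI)
  qed
  have distrib: "X + (Y \<union> Z) = (X + Y) \<union> (X + Z)" "(X \<union> Y) + Z = (X + Z) \<union> (Y + Z)"
    for X Y Z :: "int multiset set"
    by (auto simp: set_plus_def)
  have A: "ai_semiring A"
  proof
    show "x \<oplus>\<^bsub>A\<^esub> y \<in> carrier A" "x \<odot>\<^bsub>A\<^esub> y \<in> carrier A"
      if "x \<in> carrier A" "y \<in> carrier A" for x y
      using closed[OF that] by simp_all
  qed (simp_all add: A_def distrib add.assoc Un_ac)
  have "countable (range (\<lambda>t. contexts ?L (eval sumset_alg \<gamma> t)))" by simp
  then have "countable (contexts ?L ` carrier A)" by (simp add: A_def image_image)
  then obtain f :: "int multiset set \<Rightarrow> 'b" where f: "inj_on f (contexts ?L ` carrier A)"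
  proof -
    obtain g :: "int multiset set \<Rightarrow> nat" where "inj_on g (contexts ?L ` carrier A)"
      using \<open>countable (contexts ?L ` carrier A)\<close> by (rule countableE)
    moreover obtain h :: "nat \<Rightarrow> 'b" where "inj h"
      using infinite_countable_subset[OF assms(1)] by blast
    ultimately have "inj_on (h \<circ> g) (contexts ?L ` carrier A)"
      by (meson comp_inj_on inj_on_subset subset_UNIV)
    then show thesis by (rule that)
  qed
  define q where "q X = f (contexts ?L X)" for X
  have q_eq: "q X = q Y \<longleftrightarrow> contexts ?L X = contexts ?L Y" if "X \<in> carrier A" "Y \<in> carrier A" for X Y
    using that f by (auto simp: q_def inj_on_eq_iff)
  obtain B where B: "ai_semiring B" "surj_hom q A B"
  proof (rule quotient_ai_semiring[OF A, of q])
    fix X X' Y Y'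
    assume *: "X \<in> carrier A" "X' \<in> carrier A" "Y \<in> carrier A" "Y' \<in> carrier A"
      "q X = q X'" "q Y = q Y'"
    have c: "contexts ?L X = contexts ?L X'" "contexts ?L Y = contexts ?L Y'"
      using * q_eq by auto
    show "q (X \<oplus>\<^bsub>A\<^esub> Y) = q (X' \<oplus>\<^bsub>A\<^esub> Y')" using c by (simp add: q_def A_def contexts_Un)
    show "q (X \<odot>\<^bsub>A\<^esub> Y) = q (X' \<odot>\<^bsub>A\<^esub> Y')"
      using contexts_plus_cong[OF c] by (simp add: q_def A_def)
  qed
  show thesis
  proof (rule that[OF B(1)])
    fix s t
    assume st: "satisfies (power_semiring :: s7 set alg) (s, t)"
      "3 * size s + 6 \<le> N" "3 * size t + 6 \<le> N"
    have ts: "satisfies (power_semiring :: s7 set alg) (t, s)"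
      using st(1) by (simp add: satisfies_def)
    have "contexts ?L (eval sumset_alg \<rho> s) = contexts ?L (eval sumset_alg \<rho> t)" for \<rho>
    proof
      have n: "3 * int (size s) + 6 < ?n" "3 * int (size t) + 6 < ?n" using st(2,3) by linarith+
      show "contexts ?L (eval sumset_alg \<rho> t) \<subseteq> contexts ?L (eval sumset_alg \<rho> s)"
        using cyclic_words_identity[OF st(1) n(1)] unfolding contexts_def by blast
      show "contexts ?L (eval sumset_alg \<rho> s) \<subseteq> contexts ?L (eval sumset_alg \<rho> t)"
        using cyclic_words_identity[OF ts n(2)] unfolding contexts_def by blast
    qed
    then have q: "q (eval A \<rho> s) = q (eval A \<rho> t)" for \<rho> by (simp add: q_def eval_A)
    have "eval B \<rho> s = eval B \<rho> t" if \<rho>: "range \<rho> \<subseteq> carrier B" for \<rho>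
    proof -
      obtain \<rho>' where "range \<rho>' \<subseteq> carrier A" "q \<circ> \<rho>' = \<rho>"
        using surj_hom_lift_assignment[OF B(2) \<rho>] by blast
      then show ?thesis using eval_surj_hom[OF B(2) closed, of \<rho>'] q[of \<rho>'] by simp
    qed
    then show "satisfies B (s, t)" by (simp add: satisfies_def)
  next
    let ?t = "sum_tm (edge_tm N) N"
    have \<gamma>: "range \<gamma> \<subseteq> carrier A"
    proof -
      have "\<gamma> x = eval sumset_alg \<gamma> (Var x)" for x by simp
      then have "\<gamma> x \<in> range (eval sumset_alg \<gamma>)" for x by (metis rangeI)
      then show ?thesis by (auto simp: A_def)
    qed
    \<comment> \<open>The empty context separates the two sides: all edges lie in \<open>L\<close>,
      but the product of all letters does not.\<close>
    have "{#} \<in> contexts ?L (eval sumset_alg \<gamma> ?t)"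
      using eval_edge_tm_letters[OF N] unfolding contexts_def eval_sum_tm_sumset \<gamma>_def by auto
    moreover have "{#} \<notin> contexts ?L (eval sumset_alg \<gamma> (Add ?t (prod_tm N)))"
      using prod_word_not_cyclic[OF N refl] eval_prod_tm_letters[of N]
      unfolding contexts_def \<gamma>_def by auto
    ultimately have "q (eval A \<gamma> (Add ?t (prod_tm N))) \<noteq> q (eval A \<gamma> ?t)"
      using q_eq[OF eval_in_carrier[OF closed \<gamma>] eval_in_carrier[OF closed \<gamma>]]
      unfolding eval_A by blast
    then have "eval B (q \<circ> \<gamma>) (Add ?t (prod_tm N)) \<noteq> eval B (q \<circ> \<gamma>) ?t"
      by (simp only: eval_surj_hom[OF B(2) closed \<gamma>] not_False_eq_True)
    moreover have "range (q \<circ> \<gamma>) \<subseteq> carrier B"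
      using \<gamma> B(2) by (auto simp: surj_hom_def)
    ultimately show "\<not> satisfies B (Add ?t (prod_tm N), ?t)"
      unfolding satisfies_def fst_conv snd_conv by blast
  qed
qed

section \<open>Passing to the type \<open>'b\<close> and the contradiction\<close>

lemma finite_UNIV_s7: "finite (UNIV :: s7 set)"
proof -
  have "(UNIV :: s7 set) = {Zero7, A7, One7}" using s7.exhaust by blast
  then show ?thesis by (metis finite.simps)
qed

theorem theorem3p9:
  assumes "infinite (UNIV :: 'b set)"
  shows "\<nexists>\<Sigma> :: identity set. finite \<Sigma> \<and>
    (models \<Sigma> :: 'b alg set) = variety (power_semiring :: s7 set alg)"
proof
  let ?P = "power_semiring :: s7 set alg"
  assume "\<exists>\<Sigma> :: identity set. finite \<Sigma> \<and> (models \<Sigma> :: 'b alg set) = variety ?P"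
  then obtain \<Sigma> :: "identity set" where fin: "finite \<Sigma>"
    and eq: "(models \<Sigma> :: 'b alg set) = variety ?P" by blast
  \<comment> \<open>The assumed equality concerns algebras on \<open>'b\<close> only. A copy of the
    finite power semiring on \<open>'b\<close> lies in the variety, hence satisfies
    \<open>\<Sigma>\<close>, and the injection carries these identities back.\<close>
  have "finite (UNIV :: s7 set set)" using finite_UNIV_s7 by (simp add: Finite_Set.finite_set)
  then obtain f :: "s7 set \<Rightarrow> 'b" where f: "inj f"
    using assms
    by (metis finite_imp_inj_to_nat_seg infinite_countable_subset inj_compose inj_on_subset subset_UNIV)
  obtain P' where P': "surj_hom f ?P P'"
    by (rule quotient_ai_semiring[OF ai_semiring_power_semiring, of f]) (auto dest: injD[OF f])
  have "P' \<in> models \<Sigma>"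
    using variety_isomorphic_copy[OF ai_semiring_power_semiring P'] eq by simp
  have valid: "satisfies ?P e" if "e \<in> \<Sigma>" for e
  proof -
    have "satisfies P' e" using \<open>P' \<in> models \<Sigma>\<close> that by (simp add: models_def)
    have "eval ?P \<rho> (fst e) = eval ?P \<rho> (snd e)" for \<rho>
    proof -
      have "range (f \<circ> \<rho>) \<subseteq> carrier P'" using P' by (auto simp: surj_hom_def)
      then have "f (eval ?P \<rho> (fst e)) = f (eval ?P \<rho> (snd e))"
        using \<open>satisfies P' e\<close> eval_surj_hom[OF P', of \<rho>] by (simp add: satisfies_def)
      then show ?thesis using f by (simp add: inj_eq)
    qed
    then show ?thesis by (simp add: satisfies_def)
  qed
  \<comment> \<open>The total size bounds both sides of every identity in \<open>\<Sigma>\<close>,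
    so with \<open>N = 3 * K + 6\<close> all of them are short enough for the separating
    model.\<close>
  define K where "K = (\<Sum>e\<in>\<Sigma>. size (fst e) + size (snd e))"
  have K: "size (fst e) + size (snd e) \<le> K" if "e \<in> \<Sigma>" for e
    unfolding K_def using member_le_sum[OF that, of "\<lambda>e. size (fst e) + size (snd e)"] fin by simp
  define N where "N = 3 * K + 6"
  have N: "N \<ge> 2" by (simp add: N_def)
  obtain B :: "'b alg" where B: "ai_semiring B"
    and sat: "\<And>s t. \<lbrakk>satisfies ?P (s, t); 3 * size s + 6 \<le> N; 3 * size t + 6 \<le> N\<rbrakk> \<Longrightarrow> satisfies B (s, t)"
    and not_sat: "\<not> satisfies B (Add (sum_tm (edge_tm N) N) (prod_tm N), sum_tm (edge_tm N) N)"
    using separating_model[OF assms N] by blast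
  have "satisfies B e" if "e \<in> \<Sigma>" for e
    using sat[of "fst e" "snd e"] valid[OF that] K[OF that] by (simp add: N_def)
  then have "B \<in> models \<Sigma>" using B by (simp add: models_def)
  then have "B \<in> variety ?P" using eq by simp
  then show False
    using variety_satisfies[OF separating_identity_holds[OF N]] not_sat by blast
qed

end
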